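(* For all integers $n\ge j\ge 0$, $$(-1)^{n}\mu_{2j,2}(-1,n)>0\qquad\text{and}\qquad (-1)^{n}\mu_{2j,3}(-1,n)>0.$$
   Context: A partition is a finite weakly decreasing (possibly empty) sequence of positive integers, called its parts; $\ell(\pi)$ denotes the number of parts of the partition $\pi$. For an integer $k\ge 2$, a $k$-colored partition of $n\ge 0$ is an ordered $k$-tuple $\overrightarrow{\pi}=(\pi^{(1)},\pi^{(2)},\dots,\pi^{(k)})$ of partitions (each possibly empty) such that the sum of all parts of all the $\pi^{(i)}$ equals $n$. Its $k$-crank is defined as $\ell(\pi^{(1)})-\ell(\pi^{(2)})$. For $m\in\mathbb{Z}$, $M_k(m,n)$ denotes the number of $k$-colored partitions of $n$ with $k$-crank equal to $m$; equivalently, $$\sum_{n\ge 0}\sum_{m\in\mathbb{Z}}M_k(m,n)z^mq^n=\frac{(q;q)_\infty^{2-k}}{(zq;q)_\infty(z^{-1}q;q)_\infty},\qquad (a;q)_\infty:=\prod_{i\ge 0}(1-aq^i).$$ For integers $k\ge 2$ and $j,n\ge 0$, the $2j$-th symmetrized $k$-crank moment weighted by the parity of $k$-cranks is $$\mu_{2j,k}(-1,n):=\sum_{m=-n}^{n}\binom{m+j-1}{2j}(-1)^{m}M_{k}(m,n),$$ where the binomial coefficient is the generalized one, $\binom{x}{r}=\frac{x(x-1)\cdots(x-r+1)}{r!}$ for any integer $x$ (possibly negative) and $r\ge 0$, with $\binom{x}{0}=1$. *)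

theory Defs
  imports Complex_Main
begin

definition is_partition :: "nat list \<Rightarrow> bool" where
  "is_partition p \<longleftrightarrow> sorted_wrt (\<ge>) p \<and> (\<forall>x \<in> set p. x > 0)"

definition colored_partitions :: "nat \<Rightarrow> nat \<Rightarrow> nat list list set" where
  "colored_partitions k n =
     {ps. length ps = k \<and> (\<forall>p \<in> set ps. is_partition p) \<and> (\<Sum>p\<leftarrow>ps. sum_list p) = n}"

(* Lists are indexed from 0, so the first two colors are ps ! 0 and ps ! 1;
   this is meaningful only for tuples of length k \<ge> 2. *)
definition k_crank :: "nat list list \<Rightarrow> int" where
  "k_crank ps = int (length (ps ! 0)) - int (length (ps ! 1))"

definition M :: "nat \<Rightarrow> int \<Rightarrow> nat \<Rightarrow> nat" where
  "M k m n = card {ps \<in> colored_partitions k n. k_crank ps = m}"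

(* The value is always an integer; it is typed as a real because gchoose (the polynomial
   binomial coefficient, also for negative upper argument) and powi (integer exponents)
   are available over fields. *)
definition mu_minus_one :: "nat \<Rightarrow> nat \<Rightarrow> nat \<Rightarrow> real" where
  "mu_minus_one j k n =
     (\<Sum>m = - int n..int n.
        (of_int (m + int j - 1) gchoose (2 * j)) * (- 1) powi m * real (M k m n))"

lemma length_le_sum_list_pos:
  fixes p :: "nat list"
  assumes "\<forall>x \<in> set p. x > 0"
  shows "length p \<le> sum_list p"
  using assms by (induction p) auto

(* Hence M really counts: card would be 0 on an infinite set. *)
lemma finite_colored_partitions: "finite (colored_partitions k n)"
proof -
  let ?P = "{p :: nat list. set p \<subseteq> {..n} \<and> length p \<le> n}"
  have "p \<in> ?P" if ps: "ps \<in> colored_partitions k n" and p: "p \<in> set ps" for ps p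
  proof -
    have "sum_list p \<le> (\<Sum>p\<leftarrow>ps. sum_list p)"
      using p by (intro member_le_sum_list) auto
    then have le: "sum_list p \<le> n"
      using ps by (simp add: colored_partitions_def)
    have "length p \<le> sum_list p"
      using ps p by (intro length_le_sum_list_pos) (auto simp: colored_partitions_def is_partition_def)
    moreover have "x \<le> n" if "x \<in> set p" for x
      using member_le_sum_list[OF that] le by simp
    ultimately show ?thesis using le by auto
  qed
  then have "colored_partitions k n \<subseteq> {ps. set ps \<subseteq> ?P \<and> length ps = k}"
    by (auto simp: colored_partitions_def)
  moreover have "finite {ps. set ps \<subseteq> ?P \<and> length ps = k}"
    by (intro finite_lists_length_eq finite_lists_length_le finite_atMost)
  ultimately show ?thesis by (rule finite_subset)
qed

end

theory Submission
  imports Defs "HOL-Computational_Algebra.Formal_Power_Series"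
begin

text \<open>
  With \<open>w = z - 2 + 1/z\<close>, the generalized binomials \<open>B\<^sub>j(m) = binom(m+j-1, 2j)\<close> satisfy
  \<open>B\<^sub>j(m+1) - 2 B\<^sub>j(m) + B\<^sub>j(m-1) = B\<^sub>j\<^sub>-\<^sub>1(m)\<close> and \<open>B\<^sub>j(0) = 0\<close> for \<open>j > 0\<close>, so summing against
  \<open>B\<^sub>j\<close> extracts the coefficient of \<open>w^j\<close>.  After \<open>z \<rightarrow> -z\<close>, \<open>q \<rightarrow> -q\<close> the signed moments
  therefore have the generating function
  \<open>G = K \<cdot> prod\<^sub>r 1 / ((1 - x\<^sub>r)^2 - x\<^sub>r w)\<close>, where \<open>x\<^sub>r = (-1)^(r+1) q^r\<close> and \<open>K\<close> is the contribution
  of the third color, if any.  Taking the logarithmic derivative in \<open>w\<close>, its coefficients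
  \<open>g\<^sub>j\<close> satisfy Newton's recursion \<open>(j+1) g\<^sub>j\<^sub>+\<^sub>1 = sum\<^sub>i g\<^sub>i p\<^sub>j\<^sub>-\<^sub>i\<^sub>+\<^sub>1\<close> with the power sums
  \<open>p\<^sub>i = sum\<^sub>r (x\<^sub>r / (1 - x\<^sub>r)^2)^i\<close>.  These have nonnegative coefficients, because the
  coefficients of \<open>(x / (1 - x)^2)^i\<close> increase.  Euler's product identity
  \<open>prod (1 - x\<^sub>r) = 1 / prod (1 + q^(2r-1))\<close> shows that \<open>g\<^sub>0\<close> has positive coefficients.

  All products are truncated to parts of size at most \<open>2N\<close>; the identities survive up to
  factors \<open>1 - q^(2s)\<close> with \<open>N < s \<le> 2N\<close>, whose reciprocals have nonnegative coefficients.
\<close>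

section \<open>Generating functions of tuples with bounded parts\<close>

unbundle fps_syntax

definition bounded_tuples :: "nat \<Rightarrow> (nat \<Rightarrow> nat) \<Rightarrow> nat \<Rightarrow> nat list list set" where
  "bounded_tuples k N n = {ps \<in> colored_partitions k n. \<forall>i<k. \<forall>x\<in>set (ps ! i). x \<le> N i}"

definition tuple_gf :: "nat \<Rightarrow> (nat \<Rightarrow> nat) \<Rightarrow> (nat list list \<Rightarrow> real) \<Rightarrow> real fps" where
  "tuple_gf k N f = Abs_fps (\<lambda>n. \<Sum>ps\<in>bounded_tuples k N n. f ps)"

abbreviation add_part :: "nat \<Rightarrow> nat \<Rightarrow> nat list list \<Rightarrow> nat list list" where
  "add_part i a ps \<equiv> ps[i := a # ps ! i]"

lemma finite_bounded_tuples: "finite (bounded_tuples k N n)"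
  unfolding bounded_tuples_def using finite_colored_partitions by simp

lemma is_partition_Cons:
  "is_partition (a # p) \<longleftrightarrow> a > 0 \<and> (\<forall>x\<in>set p. x \<le> a) \<and> is_partition p"
  by (auto simp: is_partition_def)

lemma sum_list_add_part:
  assumes "i < length ps"
  shows "sum_list (map sum_list (add_part i a ps)) = a + sum_list (map sum_list ps)"
proof -
  have "sum_list (ps ! i) \<le> sum_list (map sum_list ps)"
    using assms by (intro member_le_sum_list) auto
  then show ?thesis
    using assms by (simp add: map_update sum_list_update)
qed

lemma bounded_tuples_iff:
  "ps \<in> bounded_tuples k N n \<longleftrightarrow> length ps = k \<and> sum_list (map sum_list ps) = n \<and>
     (\<forall>i<k. is_partition (ps ! i) \<and> (\<forall>x\<in>set (ps ! i). x \<le> N i))"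
  by (auto simp: bounded_tuples_def colored_partitions_def all_set_conv_all_nth)

text \<open>Parts decrease weakly, so color \<open>i\<close> either has all parts at most
  \<open>a\<close> or starts with \<open>Suc a\<close>. Removing that first part keeps the bound
  \<open>N\<close>, since \<open>Suc a\<close> may occur repeatedly.\<close>

lemma bounded_tuples_step:
  assumes i: "i < k" and N: "N i = Suc a"
  shows "bounded_tuples k N n = bounded_tuples k (N(i := a)) n \<union>
    add_part i (Suc a) ` {ps. \<exists>m. n = Suc a + m \<and> ps \<in> bounded_tuples k N m}" (is "?L = ?R1 \<union> ?R2")
proof (intro equalityI subsetI)
  fix ps assume ps: "ps \<in> ?L"
  show "ps \<in> ?R1 \<union> ?R2"
  proof (cases "ps \<in> ?R1")
    case False
    have len: "length ps = k" and pp: "\<And>l. l < k \<Longrightarrow> is_partition (ps ! l)"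
      and le: "\<And>l x. l < k \<Longrightarrow> x \<in> set (ps ! l) \<Longrightarrow> x \<le> N l"
      and sm: "sum_list (map sum_list ps) = n"
      using ps by (auto simp: bounded_tuples_iff)
    have "\<not> (\<forall>x\<in>set (ps ! i). x \<le> a)"
      using False len pp le sm by (auto simp: bounded_tuples_iff split: if_splits)
    then obtain x where x: "x \<in> set (ps ! i)" "x > a"
      by (auto simp: not_le)
    then obtain y p where yp: "ps ! i = y # p"
      by (cases "ps ! i") auto
    have "x \<le> y" using x(1) pp[OF i] by (auto simp: yp is_partition_Cons)
    moreover have "y \<le> Suc a" using le[OF i, of y] by (simp add: yp N)
    ultimately have y: "y = Suc a" using x(2) by simp
    let ?qs = "ps[i := p]"
    have eq: "ps = add_part i (Suc a) ?qs"
      using i len list_update_id[of ps i] by (simp add: yp y)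
    have "sum_list (map sum_list ps) = Suc a + sum_list (map sum_list ?qs)"
      using sum_list_add_part[of i ?qs "Suc a"] eq i len by simp
    moreover have "is_partition p" "\<forall>x\<in>set p. x \<le> Suc a"
      using pp[OF i] by (auto simp: yp y is_partition_Cons)
    ultimately have "?qs \<in> {ps. \<exists>m. n = Suc a + m \<and> ps \<in> bounded_tuples k N m}"
      using i pp le sm len by (auto simp: bounded_tuples_iff nth_list_update N split: if_splits)
    with eq show ?thesis by blast
  qed auto
next
  fix ps assume "ps \<in> ?R1 \<union> ?R2"
  then show "ps \<in> ?L"
  proof
    assume "ps \<in> ?R1"
    then show ?thesis
      using N by (auto simp: bounded_tuples_iff split: if_splits) (metis le_SucI)
  next
    assume "ps \<in> ?R2"
    then obtain qs m where qs: "ps = add_part i (Suc a) qs" "n = Suc a + m" "qs \<in> bounded_tuples k N m"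
      by blast
    then show ?thesis
      using i N by (auto simp: bounded_tuples_iff sum_list_add_part nth_list_update is_partition_Cons)
  qed
qed

lemma inj_on_add_part: "i < k \<Longrightarrow> inj_on (add_part i a) {ps. length ps = k}"
  by (rule inj_onI) (metis (mono_tags, lifting) list.inject list_update_id list_update_overwrite
      mem_Collect_eq nth_list_update_eq)

text \<open>The last series keeps the bound \<open>N\<close>; for a weight that ignores the new part
  this amounts to the factor 1/(1 - q^(a+1)).\<close>

lemma tuple_gf_step:
  assumes i: "i < k" and N: "N i = Suc a"
  shows "tuple_gf k N f = tuple_gf k (N(i := a)) f +
    fps_X ^ Suc a * tuple_gf k N (\<lambda>ps. f (add_part i (Suc a) ps))"
proof (rule fps_ext)
  fix n
  let ?B = "{ps. \<exists>m. n = Suc a + m \<and> ps \<in> bounded_tuples k N m}"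
  have B: "?B = (if n < Suc a then {} else bounded_tuples k N (n - Suc a))"
  proof (cases "n < Suc a")
    case False
    then have "n = Suc a + m \<longleftrightarrow> m = n - Suc a" for m by auto
    then show ?thesis using False by simp
  qed auto
  have fin: "finite ?B" unfolding B by (simp add: finite_bounded_tuples)
  have len: "ps \<in> ?B \<Longrightarrow> length ps = k" for ps by (auto simp: bounded_tuples_iff)
  have inj: "inj_on (add_part i (Suc a)) ?B"
    by (rule inj_on_subset[OF inj_on_add_part[OF i]]) (use len in auto)
  have disj: "bounded_tuples k (N(i := a)) n \<inter> add_part i (Suc a) ` ?B = {}"
    using i len by (fastforce simp: bounded_tuples_iff[of _ _ "N(i := a)"])
  have "sum f (bounded_tuples k N n) =
      sum f (bounded_tuples k (N(i := a)) n) + sum f (add_part i (Suc a) ` ?B)"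
    unfolding bounded_tuples_step[where k = k and N = N and n = n, OF i N]
    by (rule sum.union_disjoint) (use fin disj finite_bounded_tuples in auto)
  also have "sum f (add_part i (Suc a) ` ?B) = (\<Sum>ps\<in>?B. f (add_part i (Suc a) ps))"
    using sum.reindex[OF inj, of f] by (simp only: o_def)
  finally show "tuple_gf k N f $ n = (tuple_gf k (N(i := a)) f +
    fps_X ^ Suc a * tuple_gf k N (\<lambda>ps. f (add_part i (Suc a) ps))) $ n"
    unfolding B by (simp add: tuple_gf_def fps_X_power_mult_nth del: power_Suc fun_upd_apply)
qed

lemma bounded_tuples_0:
  "bounded_tuples k (\<lambda>i. 0) n = (if n = 0 then {replicate k []} else {})"
proof -
  have "ps = replicate k []" if "ps \<in> bounded_tuples k (\<lambda>i. 0) n" for ps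
  proof (rule nth_equalityI)
    fix i assume "i < length ps"
    then have "\<forall>x\<in>set (ps ! i). x > 0 \<and> x \<le> 0"
      using that by (auto simp: bounded_tuples_iff is_partition_def)
    then show "ps ! i = replicate k [] ! i"
      using \<open>i < length ps\<close> that by (cases "ps ! i") (auto simp: bounded_tuples_iff)
  qed (use that in \<open>simp add: bounded_tuples_iff\<close>)
  moreover have sum0: "sum_list (map sum_list (replicate k [] :: nat list list)) = 0"
    by (induction k) auto
  moreover have "replicate k [] \<in> bounded_tuples k (\<lambda>i. 0) 0"
    using sum0 by (simp add: bounded_tuples_iff is_partition_def)
  moreover have "n = sum_list (map sum_list ps)" if "ps \<in> bounded_tuples k (\<lambda>i. 0) n" for ps
    using that by (simp add: bounded_tuples_iff)
  ultimately have "ps \<in> bounded_tuples k (\<lambda>i. 0) n \<longleftrightarrow> n = 0 \<and> ps = replicate k []" for ps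
    by metis
  then show ?thesis by auto
qed

lemma tuple_gf_0: "tuple_gf k (\<lambda>i. 0) f = fps_const (f (replicate k []))"
  by (rule fps_ext) (simp add: tuple_gf_def bounded_tuples_0)

lemma tuple_gf_add: "tuple_gf k N (\<lambda>ps. f ps + g ps) = tuple_gf k N f + tuple_gf k N g"
  by (rule fps_ext) (simp add: tuple_gf_def sum.distrib)

lemma tuple_gf_cmult: "tuple_gf k N (\<lambda>ps. c * f ps) = fps_const c * tuple_gf k N f"
  by (rule fps_ext) (simp add: tuple_gf_def sum_distrib_left)

section \<open>Symmetrized crank moments\<close>

text \<open>Replacing \<open>q\<close> by \<open>-q\<close> gives a part \<open>i\<close> of the first two colors the sign \<open>(-1)^(i+1)\<close>,
  and a part \<open>i\<close> of any other color the sign \<open>(-1)^i\<close>.\<close>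

definition tuple_sign :: "nat list list \<Rightarrow> real" where
  "tuple_sign ps = (-1) ^ (sum_list (map sum_list ps) + length (ps ! 0) + length (ps ! 1))"

text \<open>No variable z occurs: \<open>\<phi>\<close> assigns a value to each power z^m, and
  multiplication by z becomes a shift of the argument of \<open>\<phi>\<close>.\<close>

definition crank_gf :: "nat \<Rightarrow> (nat \<Rightarrow> nat) \<Rightarrow> (int \<Rightarrow> real) \<Rightarrow> real fps" where
  "crank_gf k N \<phi> = tuple_gf k N (\<lambda>ps. tuple_sign ps * \<phi> (k_crank ps))"

lemma tuple_gf_cong:
  assumes "\<And>ps. length ps = k \<Longrightarrow> f ps = g ps"
  shows "tuple_gf k N f = tuple_gf k N g"
  unfolding tuple_gf_def using assms
  by (intro fps_ext) (auto simp: bounded_tuples_iff intro!: sum.cong)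

lemma crank_gf_0:
  assumes "k \<ge> 2"
  shows "crank_gf k (\<lambda>i. 0) \<phi> = fps_const (\<phi> 0)"
proof -
  have "sum_list (replicate k (0 :: nat)) = 0"
    by (induction k) auto
  then show ?thesis
    using assms by (simp add: crank_gf_def tuple_gf_0 tuple_sign_def k_crank_def del: sum_list_eq_0_iff)
qed

lemma crank_gf_add: "crank_gf k N (\<lambda>m. \<phi> m + \<psi> m) = crank_gf k N \<phi> + crank_gf k N \<psi>"
  by (simp add: crank_gf_def distrib_left tuple_gf_add)

lemma crank_gf_cmult: "crank_gf k N (\<lambda>m. c * \<phi> m) = fps_const c * crank_gf k N \<phi>"
  using tuple_gf_cmult[of k N c "\<lambda>ps. tuple_sign ps * \<phi> (k_crank ps)"]
  by (simp add: crank_gf_def mult_ac)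

lemma crank_gf_step:
  assumes "i < k" "k \<ge> 2" "N i = Suc a"
  shows "crank_gf k N \<phi> = crank_gf k (N(i := a)) \<phi> +
    fps_const (if i < 2 then (-1) ^ a else (-1) ^ Suc a) * fps_X ^ Suc a *
      crank_gf k N (\<lambda>m. \<phi> (if i = 0 then m + 1 else if i = 1 then m - 1 else m))"
proof -
  let ?c = "if i < 2 then (-1) ^ a else (-1) ^ Suc a :: real"
  have "tuple_gf k N (\<lambda>ps. tuple_sign (add_part i (Suc a) ps) * \<phi> (k_crank (add_part i (Suc a) ps))) =
    tuple_gf k N (\<lambda>ps. ?c * (tuple_sign ps *
      \<phi> (if i = 0 then k_crank ps + 1 else if i = 1 then k_crank ps - 1 else k_crank ps)))"
  proof (rule tuple_gf_cong)
    fix ps :: "nat list list" assume len: "length ps = k"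
    have "i = 0 \<or> i = 1 \<or> i \<ge> 2" by auto
    moreover have "tuple_sign (add_part i (Suc a) ps) = ?c * tuple_sign ps"
      using assms len calculation
      by (auto simp: tuple_sign_def sum_list_add_part power_add)
    moreover have "k_crank (add_part i (Suc a) ps) =
        (if i = 0 then k_crank ps + 1 else if i = 1 then k_crank ps - 1 else k_crank ps)"
      using assms len calculation(1)
      by (auto simp: k_crank_def)
    ultimately show "tuple_sign (add_part i (Suc a) ps) * \<phi> (k_crank (add_part i (Suc a) ps)) =
      ?c * (tuple_sign ps *
      \<phi> (if i = 0 then k_crank ps + 1 else if i = 1 then k_crank ps - 1 else k_crank ps))"
      by simp
  qed
  then show ?thesis
    unfolding crank_gf_def
    by (subst tuple_gf_step[where k = k and N = N and f = "\<lambda>ps. tuple_sign ps * \<phi> (k_crank ps)", OF assms(1,3)])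
      (simp only: tuple_gf_cmult, simp only: mult_ac)
qed

section \<open>Binomial weights\<close>

definition crank_binomial :: "nat \<Rightarrow> int \<Rightarrow> real" where
  "crank_binomial j m = of_int (m + int j - 1) gchoose (2 * j)"

lemma crank_binomial_0 [simp]: "crank_binomial 0 m = 1"
  by (simp add: crank_binomial_def)

lemma crank_binomial_at_0: "crank_binomial j 0 = (if j = 0 then 1 else 0)"
proof (cases j)
  case (Suc l)
  have "(of_nat l :: real) gchoose (2 * Suc l) = of_nat (l choose (2 * Suc l))"
    by (rule binomial_gbinomial[symmetric])
  then show ?thesis by (simp add: crank_binomial_def Suc)
qed simp

text \<open>Pascal's rule expresses all four values through binomials with upper argument
  \<open>a\<close>.\<close>

lemma crank_binomial_second_difference:
  "crank_binomial (Suc j) (m + 1) + crank_binomial (Suc j) (m - 1) =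
     2 * crank_binomial (Suc j) m + crank_binomial j m"
proof -
  define a :: real where "a = of_int (m + int j - 1)"
  have pascal: "((x + 1) gchoose Suc l) = (x gchoose l) + (x gchoose Suc l)" for x :: real and l
    by (rule gbinomial_Suc_Suc)
  have "crank_binomial (Suc j) (m + 1) = (a + 1 + 1) gchoose Suc (Suc (2 * j))"
    "crank_binomial (Suc j) m = (a + 1) gchoose Suc (Suc (2 * j))"
    "crank_binomial (Suc j) (m - 1) = a gchoose Suc (Suc (2 * j))"
    "crank_binomial j m = a gchoose (2 * j)"
    by (simp_all add: crank_binomial_def a_def algebra_simps)
  then show ?thesis by (simp only: pascal) simp
qed

text \<open>Parts of a tuple of total \<open>n\<close> are at most \<open>n\<close>, so the bounds
  exclude nothing. The crank lies between -n and n, so the sum over \<open>m\<close> is the sum over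
  all tuples, grouped by crank.\<close>

lemma mu_minus_one_eq_coeff:
  assumes k: "k \<ge> 2" and "\<And>i. i < k \<Longrightarrow> N i \<ge> n"
  shows "(-1) ^ n * mu_minus_one j k n = crank_gf k N (crank_binomial j) $ n"
proof -
  have bt: "bounded_tuples k N n = colored_partitions k n"
  proof -
    have "x \<le> N i" if "ps \<in> colored_partitions k n" "i < k" "x \<in> set (ps ! i)" for ps i x
    proof -
      have "x \<le> sum_list (ps ! i)" using that by (intro member_le_sum_list) auto
      also have "\<dots> \<le> sum_list (map sum_list ps)"
        using that by (intro member_le_sum_list) (auto simp: colored_partitions_def)
      also have "\<dots> \<le> N i" using that assms by (auto simp: colored_partitions_def)
      finally show ?thesis .
    qed
    then show ?thesis by (auto simp: bounded_tuples_def)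
  qed
  have "(-1) ^ n * mu_minus_one j k n =
      (\<Sum>m = - int n..int n. \<Sum>ps | ps \<in> colored_partitions k n \<and> k_crank ps = m.
        (-1) ^ n * (crank_binomial j m * (-1) powi m))"
    by (simp add: mu_minus_one_def M_def crank_binomial_def sum_distrib_left mult_ac)
  also have "\<dots> = (\<Sum>m = - int n..int n. \<Sum>ps | ps \<in> colored_partitions k n \<and> k_crank ps = m.
        tuple_sign ps * crank_binomial j (k_crank ps))"
  proof (intro sum.cong refl)
    fix m ps assume "ps \<in> {ps \<in> colored_partitions k n. k_crank ps = m}"
    then have n: "sum_list (map sum_list ps) = n" and m: "k_crank ps = m"
      by (auto simp: colored_partitions_def)
    \<comment> \<open>The difference and the sum of the two lengths have the same parity, which
      brings in \<open>tuple_sign\<close>.\<close>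
    have "(-1 :: real) powi m = (-1) ^ (length (ps ! 0) + length (ps ! 1))"
      unfolding m[symmetric] k_crank_def
      by (cases "even (length (ps ! 1))") (simp_all add: power_int_diff power_add)
    then show "(-1) ^ n * (crank_binomial j m * (-1) powi m) =
      tuple_sign ps * crank_binomial j (k_crank ps)"
      by (simp add: tuple_sign_def n m power_add)
  qed
  also have "\<dots> = (\<Sum>ps\<in>colored_partitions k n. tuple_sign ps * crank_binomial j (k_crank ps))"
  proof (rule sum.group[OF finite_colored_partitions])
    show "k_crank ` colored_partitions k n \<subseteq> {- int n..int n}"
    proof (intro image_subsetI)
      fix ps assume ps: "ps \<in> colored_partitions k n"
      have "length (ps ! i) \<le> n" if "i < k" for i
      proof -
        have "length (ps ! i) \<le> sum_list (ps ! i)"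
          using that ps
          by (intro length_le_sum_list_pos) (auto simp: colored_partitions_def is_partition_def)
        also have "\<dots> \<le> sum_list (map sum_list ps)"
          using that ps by (intro member_le_sum_list) (auto simp: colored_partitions_def)
        finally show ?thesis using ps by (simp add: colored_partitions_def)
      qed
      from this[of 0] this[of 1] show "k_crank ps \<in> {- int n..int n}"
        using k by (auto simp: k_crank_def)
    qed
  qed simp
  finally show ?thesis
    by (simp add: crank_gf_def tuple_gf_def bt)
qed

section \<open>Power series with nonnegative coefficients\<close>

definition fps_nonneg :: "real fps \<Rightarrow> bool" where
  "fps_nonneg f \<longleftrightarrow> (\<forall>n. f $ n \<ge> 0)"

lemma fps_nonneg_1: "fps_nonneg 1"
  and fps_nonneg_X_power: "fps_nonneg (fps_X ^ n)"
  by (auto simp: fps_nonneg_def fps_X_power_nth)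

lemma fps_nonneg_add: "fps_nonneg f \<Longrightarrow> fps_nonneg g \<Longrightarrow> fps_nonneg (f + g)"
  by (simp add: fps_nonneg_def)

lemma fps_nonneg_mult: "fps_nonneg f \<Longrightarrow> fps_nonneg g \<Longrightarrow> fps_nonneg (f * g)"
  by (auto simp: fps_nonneg_def fps_mult_nth intro!: sum_nonneg)

lemma fps_nonneg_sum: "(\<And>i. i \<in> A \<Longrightarrow> fps_nonneg (f i)) \<Longrightarrow> fps_nonneg (sum f A)"
  by (auto simp: fps_nonneg_def fps_sum_nth intro!: sum_nonneg)

lemma fps_nonneg_prod: "(\<And>i. i \<in> A \<Longrightarrow> fps_nonneg (f i)) \<Longrightarrow> fps_nonneg (prod f A)"
  by (induction A rule: infinite_finite_induct) (auto intro: fps_nonneg_1 fps_nonneg_mult)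

lemma fps_nonneg_power: "fps_nonneg f \<Longrightarrow> fps_nonneg (f ^ n)"
  by (induction n) (auto intro: fps_nonneg_1 fps_nonneg_mult)

lemma fps_mult_nth_pos:
  assumes "fps_nonneg f" "fps_nonneg g" "f $ n > 0" "g $ m > 0"
  shows "(f * g) $ (n + m) > 0"
  unfolding fps_mult_nth
  by (rule sum_pos2[of _ n]) (use assms in \<open>auto simp: fps_nonneg_def\<close>)

lemma fps_nth_0_prod: "prod f A $ 0 = (\<Prod>i\<in>A. f i $ 0)"
  for f :: "'b \<Rightarrow> 'a::comm_semiring_1 fps"
  by (induction A rule: infinite_finite_induct) auto

lemma fps_compose_monom_nth:
  fixes f :: "'a::comm_ring_1 fps"
  shows "(f oo (fps_const c * fps_X ^ m)) $ n = (\<Sum>i=0..n. if m * i = n then c ^ i * f $ i else 0)"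
proof -
  have "((fps_const c * fps_X ^ m) ^ i) $ n = (if m * i = n then c ^ i else 0)" for i
    by (simp add: power_mult_distrib fps_const_power fps_X_power_nth flip: power_mult)
  then show ?thesis
    unfolding fps_compose_nth by (intro sum.cong) simp_all
qed

definition geom :: "nat \<Rightarrow> real fps" where
  "geom m = Abs_fps (\<lambda>_. 1) oo fps_X ^ m"

lemma geom_nth: "geom m $ n = (\<Sum>i=0..n. if m * i = n then 1 else 0)"
  using fps_compose_monom_nth[of "Abs_fps (\<lambda>_. 1 :: real)" 1 m n]
  by (simp add: geom_def cong: if_cong)

lemma fps_nonneg_geom: "fps_nonneg (geom m)"
  by (auto simp: fps_nonneg_def geom_nth intro!: sum_nonneg)

lemma ones_times_one_minus_X: "Abs_fps (\<lambda>_. 1 :: real) * (1 - fps_X) = 1"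
  by (rule fps_ext) (simp add: algebra_simps split: nat.split)

lemma geom_times: "m > 0 \<Longrightarrow> geom m * (1 - fps_X ^ m) = 1"
  unfolding geom_def
  using fps_compose_mult_distrib[of "fps_X ^ m :: real fps" "Abs_fps (\<lambda>_. 1)" "1 - fps_X"]
  by (simp add: ones_times_one_minus_X fps_compose_sub_distrib)

lemma geom_nth_0: "geom m $ 0 = 1"
  by (simp add: geom_nth)

lemma geom_2_nth_pos:
  assumes "even n"
  shows "geom 2 $ n > 0"
  unfolding geom_nth
  by (rule sum_pos2[of _ "n div 2"]) (use assms in auto)

section \<open>The power sums\<close>

text \<open>The Koebe function x/(1 - x)^2 = x + 2 x^2 + 3 x^3 + ...\<close>

definition koebe :: "real fps" where
  "koebe = fps_X * Abs_fps (\<lambda>_. 1) ^ 2"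

lemma koebe_eq: "koebe * (1 - fps_X) ^ 2 = fps_X"
proof -
  have "koebe * (1 - fps_X) ^ 2 = fps_X * (Abs_fps (\<lambda>_. 1 :: real) * (1 - fps_X)) ^ 2"
    unfolding koebe_def power_mult_distrib by (simp only: mult_ac)
  then show ?thesis by (simp add: ones_times_one_minus_X)
qed

text \<open>Coefficients increase if multiplication by 1 - x leaves nonnegative ones. It only
  cancels one of the factors 1/(1 - x), of which a positive power has at least two.\<close>

lemma koebe_power_mono:
  assumes "m \<le> n"
  shows "(koebe ^ Suc i) $ m \<le> (koebe ^ Suc i) $ n"
proof -
  have nn: "fps_nonneg (Abs_fps (\<lambda>_. 1))" by (simp add: fps_nonneg_def)
  let ?f = "koebe ^ i * fps_X * Abs_fps (\<lambda>_. 1)"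
  have "koebe ^ Suc i * (1 - fps_X) = ?f * (Abs_fps (\<lambda>_. 1 :: real) * (1 - fps_X))"
    by (simp add: koebe_def power2_eq_square mult_ac)
  also have "\<dots> = ?f" by (simp only: ones_times_one_minus_X mult_1_right)
  finally have eq: "koebe ^ Suc i * (1 - fps_X) = ?f" .
  have "fps_nonneg koebe"
    unfolding koebe_def using fps_nonneg_X_power[of 1]
    by (intro fps_nonneg_mult fps_nonneg_power nn) simp
  then have "fps_nonneg ?f"
    using fps_nonneg_X_power[of 1] by (intro fps_nonneg_mult fps_nonneg_power nn) simp_all
  then have "(koebe ^ Suc i * (1 - fps_X)) $ Suc l \<ge> 0" for l
    unfolding eq fps_nonneg_def by blast
  then have "(koebe ^ Suc i) $ l \<le> (koebe ^ Suc i) $ Suc l" for l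
    by (simp add: right_diff_distrib del: power_Suc)
  then show ?thesis by (rule lift_Suc_mono_le[OF _ assms])
qed

lemma koebe_nth_0: "koebe $ 0 = 0" and koebe_nth_1: "koebe $ 1 = 1"
  by (simp_all add: koebe_def power2_eq_square)

text \<open>Index \<open>r\<close> stands for the part size r + 1, whose sign (-1)^(r+2) equals
  (-1)^r.\<close>

definition signed_monom :: "nat \<Rightarrow> real fps" where
  "signed_monom r = fps_const ((-1) ^ r) * fps_X ^ Suc r"

definition signed_koebe :: "nat \<Rightarrow> real fps" where
  "signed_koebe r = koebe oo signed_monom r"

lemma signed_monom_nth_0: "signed_monom r $ 0 = 0"
  by (simp add: signed_monom_def)

lemma signed_koebe_eq: "(1 - signed_monom r) ^ 2 * signed_koebe r = signed_monom r"
proof -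
  have "(koebe * (1 - fps_X) ^ 2) oo signed_monom r = signed_koebe r * (1 - signed_monom r) ^ 2"
    by (simp add: signed_koebe_def fps_compose_mult_distrib[OF signed_monom_nth_0]
        fps_compose_sub_distrib signed_monom_nth_0 flip: fps_compose_power[OF signed_monom_nth_0])
  then show ?thesis by (simp add: koebe_eq signed_monom_nth_0 mult.commute)
qed

text \<open>The negative terms come from \<open>(s, m)\<close> with \<open>s\<close> even and \<open>m\<close> odd; each is
  compensated by the positive term from \<open>(s / 2, 2 m)\<close>.\<close>

lemma signed_divisor_sum_nonneg:
  fixes c :: "nat \<Rightarrow> real"
  assumes c: "\<And>m. c m \<ge> 0" "\<And>m. c m \<le> c (2 * m)" and A: "A = {(s, m). 1 \<le> s \<and> s \<le> a \<and> m \<le> n \<and> s * m = n}"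
  shows "(\<Sum>(s, m)\<in>A. (-1) ^ ((s - 1) * m) * c m) \<ge> 0"
proof (cases "n = 0")
  case True
  then show ?thesis using c(1) by (auto intro!: sum_nonneg simp: A)
next
  case n: False
  define Neg where "Neg = {p \<in> A. even (fst p) \<and> odd (snd p)}"
  define \<theta> :: "nat \<times> nat \<Rightarrow> nat \<times> nat" where "\<theta> = (\<lambda>(s, m). (s div 2, 2 * m))"
  have fin: "finite A"
    by (rule finite_subset[of _ "{..a} \<times> {..n}"]) (auto simp: A)
  have inj: "inj_on \<theta> Neg"
    by (auto simp: inj_on_def Neg_def \<theta>_def)
  \<comment> \<open>Doubling makes the second component even, so the image avoids
    \<open>Neg\<close>.\<close>
  have sub: "\<theta> ` Neg \<subseteq> A - Neg"
  proof (rule image_subsetI)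
    fix p assume p: "p \<in> Neg"
    obtain s m where sm: "p = (s, m)" by fastforce
    from p sm obtain t where t: "s = 2 * t" by (auto simp: Neg_def elim: evenE)
    from p sm t n have "1 \<le> t" "t \<le> a" "t * (2 * m) = n" by (auto simp: Neg_def A)
    moreover from this have "2 * m \<le> n" by (metis One_nat_def le_add1 less_eq_Suc_le mult_le_mono1 mult_1)
    ultimately show "\<theta> p \<in> A - Neg" by (simp add: \<theta>_def sm t A Neg_def)
  qed
  have "(\<Sum>p\<in>Neg. c (snd p)) \<le> (\<Sum>p\<in>Neg. c (snd (\<theta> p)))"
    using c(2) by (intro sum_mono) (auto simp: \<theta>_def)
  also have "\<dots> = (\<Sum>p\<in>\<theta> ` Neg. c (snd p))"
    by (simp add: sum.reindex[OF inj])
  also have "\<dots> \<le> (\<Sum>p\<in>A - Neg. c (snd p))"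
    using fin sub c(1) by (intro sum_mono2) auto
  finally have "0 \<le> (\<Sum>p\<in>A - Neg. c (snd p)) + (\<Sum>p\<in>Neg. - c (snd p))"
    by (simp add: sum_negf)
  also have "(\<Sum>p\<in>A - Neg. c (snd p)) = (\<Sum>p\<in>A - Neg. (-1) ^ ((fst p - 1) * snd p) * c (snd p))"
    by (intro sum.cong) (auto simp: Neg_def A)
  also have "(\<Sum>p\<in>Neg. - c (snd p)) = (\<Sum>p\<in>Neg. (-1) ^ ((fst p - 1) * snd p) * c (snd p))"
    by (intro sum.cong) (auto simp: Neg_def A)
  also have "(\<Sum>p\<in>A - Neg. (-1) ^ ((fst p - 1) * snd p) * c (snd p)) +
      (\<Sum>p\<in>Neg. (-1) ^ ((fst p - 1) * snd p) * c (snd p)) =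
      (\<Sum>p\<in>A. (-1) ^ ((fst p - 1) * snd p) * c (snd p))"
    using fin by (intro sum.subset_diff[symmetric]) (auto simp: Neg_def)
  finally show ?thesis by (simp add: case_prod_unfold)
qed

text \<open>With s = r + 1, the coefficient at n is a signed sum over the factorizations n = s m,
  weighted by the increasing coefficients of a power of \<open>koebe\<close>.\<close>

lemma signed_koebe_power_sum_nonneg: "fps_nonneg (\<Sum>r<a. signed_koebe r ^ Suc i)"
  unfolding fps_nonneg_def
proof
  fix n
  define c where "c m = (koebe ^ Suc i) $ m" for m
  have mono: "c m \<le> c m'" if "m \<le> m'" for m m'
    unfolding c_def using koebe_power_mono[OF that] .
  have "c 0 = 0" by (simp add: c_def koebe_nth_0)
  then have nonneg: "c m \<ge> 0" for m using mono[of 0 m] by simp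
  let ?A = "{(s, m). 1 \<le> s \<and> s \<le> a \<and> m \<le> n \<and> s * m = n}"
  have "(\<Sum>r<a. signed_koebe r ^ Suc i) $ n =
      (\<Sum>r<a. \<Sum>m=0..n. if Suc r * m = n then ((-1) ^ r) ^ m * c m else 0)"
    unfolding fps_sum_nth signed_koebe_def fps_compose_power[OF signed_monom_nth_0]
    unfolding signed_monom_def fps_compose_monom_nth c_def ..
  also have "\<dots> = (\<Sum>(r, m)\<in>{..<a} \<times> {0..n}. if Suc r * m = n then (-1) ^ (r * m) * c m else 0)"
    by (simp only: sum.cartesian_product power_mult)
  also have "\<dots> = (\<Sum>(r, m)\<in>{(r, m). r < a \<and> m \<le> n \<and> Suc r * m = n}. (-1) ^ (r * m) * c m)"
    by (intro sum.mono_neutral_cong_right) (auto split: if_splits)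
  also have "\<dots> = (\<Sum>(s, m)\<in>?A. (-1) ^ ((s - 1) * m) * c m)"
    by (rule sum.reindex_bij_witness[of _ "\<lambda>(s, m). (s - 1, m)" "\<lambda>(r, m). (Suc r, m)"])
      (auto simp flip: mult_Suc)
  also have "\<dots> \<ge> 0"
    using nonneg mono by (intro signed_divisor_sum_nonneg[OF _ _ refl]) auto
  finally show "(\<Sum>r<a. signed_koebe r ^ Suc i) $ n \<ge> 0" .
qed

lemma signed_koebe_sum_nth_1:
  assumes "a > 0"
  shows "(\<Sum>r<a. signed_koebe r) $ 1 > 0"
proof -
  have "signed_koebe r $ 1 = (if r = 0 then 1 else 0)" for r
    unfolding signed_koebe_def signed_monom_def fps_compose_monom_nth
    by (simp add: koebe_nth_0 koebe_nth_1[simplified])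
  then show ?thesis using assms by (simp add: fps_sum_nth)
qed

section \<open>Newton's recursion\<close>

text \<open>The variable here is w, and G = F/(\<alpha> - \<beta> w): the new factor adds
  \<beta>/(\<alpha> - \<beta> w), a geometric series in u = \<beta>/\<alpha>, to the logarithmic
  derivative. Division is avoided because the coefficients will themselves be power series in
  q.\<close>

lemma logarithmic_derivative_step:
  fixes F G P :: "'a::idom fps"
  assumes FG: "(fps_const \<alpha> - fps_const \<beta> * fps_X) * G = F" and "\<alpha> \<noteq> 0" and u: "\<alpha> * u = \<beta>"
    and F: "fps_deriv F = F * P"
  shows "fps_deriv G = G * (P + Abs_fps (\<lambda>i. u ^ Suc i))"
proof -
  let ?L = "fps_const \<alpha> - fps_const \<beta> * fps_X" and ?S = "Abs_fps (\<lambda>i. u ^ Suc i)"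
  have S: "?L * ?S = fps_const \<beta>"
  proof (rule fps_ext)
    show "(?L * ?S) $ n = fps_const \<beta> $ n" for n
      by (cases n) (simp_all add: left_diff_distrib mult.assoc u[symmetric])
  qed
  have "?L * fps_deriv G - fps_const \<beta> * G = fps_deriv F"
    by (simp add: FG[symmetric] flip: fps_const_neg)
  also have "\<dots> = ?L * G * P" by (simp add: F FG)
  finally have "?L * fps_deriv G = ?L * G * P + (?L * ?S) * G"
    unfolding S by (simp add: algebra_simps)
  then have "?L * (fps_deriv G - G * (P + ?S)) = 0"
    by (simp add: algebra_simps)
  moreover have "?L $ 0 \<noteq> 0" using \<open>\<alpha> \<noteq> 0\<close> by simp
  then have "?L \<noteq> 0" by force
  ultimately show ?thesis by simp
qed

text \<open>Strong induction first makes every \<open>g j\<close> nonnegative, so that one positive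
  term of the recursion decides. The limit \<open>L\<close> allows for a truncated
  \<open>g 0\<close> that is known to be positive only up to some exponent.\<close>

lemma newton_recursion_pos:
  fixes g p :: "nat \<Rightarrow> real fps"
  assumes rec: "\<And>j. of_nat (Suc j) * g (Suc j) = (\<Sum>i=0..j. g i * p (j - i))"
    and p: "\<And>i. fps_nonneg (p i)" "p 0 $ 1 > 0"
    and g0: "fps_nonneg (g 0)" "\<And>n. n \<le> L \<Longrightarrow> g 0 $ n > 0"
    and n: "j \<le> n" "n \<le> L"
  shows "g j $ n > 0"
proof -
  have rec_nth: "real (Suc j) * g (Suc j) $ n = (\<Sum>i=0..j. (g i * p (j - i)) $ n)" for j n
    using arg_cong[OF rec, of "\<lambda>f. f $ n"]
    by (simp add: fps_sum_nth fps_of_nat[symmetric] del: of_nat_Suc)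
  have nn: "fps_nonneg (g j)" for j
  proof (induction j rule: less_induct)
    case (less j)
    show ?case
    proof (cases j)
      case 0
      then show ?thesis using g0 by simp
    next
      case (Suc l)
      have "fps_nonneg (\<Sum>i=0..l. g i * p (l - i))"
        using less Suc p by (intro fps_nonneg_sum fps_nonneg_mult) auto
      then have "0 \<le> real (Suc l) * g (Suc l) $ n" for n
        unfolding rec_nth by (simp add: fps_nonneg_def fps_sum_nth)
      then show ?thesis
        by (simp add: Suc fps_nonneg_def zero_le_mult_iff del: of_nat_Suc)
    qed
  qed
  show ?thesis using n
  proof (induction j arbitrary: n)
    case 0
    then show ?case using g0 by simp
  next
    case (Suc j)
    then obtain m where m: "n = m + 1" by (cases n) auto
    have "0 < (\<Sum>i=0..j. (g i * p (j - i)) $ n)"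
    \<comment> \<open>The term i = j decides: \<open>p 0\<close> is positive at exponent 1, so each
      step in \<open>j\<close> costs one in the exponent. This is where \<open>j \<le> n\<close>
      enters.\<close>
    proof (rule sum_pos2[of _ j])
      show "0 < (g j * p (j - j)) $ n"
        unfolding m by (rule fps_mult_nth_pos) (use Suc m nn p in auto)
      show "0 \<le> (g i * p (j - i)) $ n" for i
        using fps_nonneg_mult[OF nn p(1)] by (auto simp: fps_nonneg_def)
    qed auto
    then show ?case
      unfolding rec_nth[symmetric] by (simp add: zero_less_mult_iff del: of_nat_Suc)
  qed
qed

section \<open>The moment generating functions\<close>

text \<open>The two crank colors share a bound because their factors are treated in pairs, symmetric
  under z -> 1/z.\<close>

definition part_bounds :: "nat \<Rightarrow> nat \<Rightarrow> nat \<Rightarrow> nat" where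
  "part_bounds a b i = (if i < 2 then a else if i = 2 then b else 0)"

text \<open>Removing the size a + 1 from color 1 and then from color 0 multiplies by (1 - x/z)(1 - x
  z) = 1 + x^2 - x (z + 1/z).\<close>

lemma crank_gf_step_crank_colors:
  fixes k a b
  defines "D \<equiv> crank_gf k (part_bounds (Suc a) b)" and "x \<equiv> signed_monom a"
  assumes k: "k \<ge> 2"
  shows "crank_gf k (part_bounds a b) \<phi> =
    (1 + x ^ 2) * D \<phi> - x * D (\<lambda>m. \<phi> (m + 1) + \<phi> (m - 1))"
proof -
  define N where "N = (part_bounds (Suc a) b)(1 := a)"
  have x: "x = fps_const ((-1) ^ a) * fps_X ^ Suc a" by (simp add: x_def signed_monom_def)
  have N1: "part_bounds (Suc a) b 1 = Suc a" and N0: "N 0 = Suc a"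
    and N2: "N(0 := a) = part_bounds a b"
    by (auto simp: N_def part_bounds_def fun_eq_iff)
  have 1: "D \<psi> = crank_gf k N \<psi> + x * D (\<lambda>m. \<psi> (m - 1))" for \<psi>
    using crank_gf_step[where k = k and N = "part_bounds (Suc a) b" and i = 1 and \<phi> = \<psi>, OF _ k N1] k
    by (simp add: D_def x N_def)
  have 2: "crank_gf k N \<psi> = crank_gf k (part_bounds a b) \<psi> + x * crank_gf k N (\<lambda>m. \<psi> (m + 1))" for \<psi>
    using crank_gf_step[where k = k and N = N and i = 0 and \<phi> = \<psi>, OF _ k N0] k
    by (simp add: N2 x del: fun_upd_apply)
  have "crank_gf k N \<phi> = D \<phi> - x * D (\<lambda>m. \<phi> (m - 1))"
    "crank_gf k N (\<lambda>m. \<phi> (m + 1)) = D (\<lambda>m. \<phi> (m + 1)) - x * D \<phi>"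
    using 1[of \<phi>] 1[of "\<lambda>m. \<phi> (m + 1)"] by simp_all
  moreover have "D (\<lambda>m. \<phi> (m + 1) + \<phi> (m - 1)) = D (\<lambda>m. \<phi> (m + 1)) + D (\<lambda>m. \<phi> (m - 1))"
    unfolding D_def by (rule crank_gf_add)
  ultimately show ?thesis
    using 2[of \<phi>] by (simp add: algebra_simps power2_eq_square)
qed

definition moment_gf :: "nat \<Rightarrow> nat \<Rightarrow> nat \<Rightarrow> nat \<Rightarrow> real fps" where
  "moment_gf k a b j = crank_gf k (part_bounds a b) (crank_binomial j)"

lemma moment_gf_0_step:
  assumes "k \<ge> 2"
  shows "moment_gf k a b 0 = (1 - signed_monom a) ^ 2 * moment_gf k (Suc a) b 0"
proof -
  have c: "crank_binomial 0 = (\<lambda>_. 1)" by auto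
  show ?thesis
    unfolding moment_gf_def c crank_gf_step_crank_colors[where a = a and b = b, OF assms]
    unfolding crank_gf_add by (simp add: power2_eq_square algebra_simps)
qed

text \<open>The factor 1 + x^2 - x (z + 1/z) is (1 - x)^2 - x w, and w takes the weight of order j +
  1 to that of order j.\<close>

lemma moment_gf_Suc_step:
  assumes "k \<ge> 2"
  shows "moment_gf k a b (Suc j) =
    (1 - signed_monom a) ^ 2 * moment_gf k (Suc a) b (Suc j) - signed_monom a * moment_gf k (Suc a) b j"
proof -
  have "crank_gf k N (\<lambda>m. crank_binomial (Suc j) (m + 1) + crank_binomial (Suc j) (m - 1)) =
      2 * crank_gf k N (crank_binomial (Suc j)) + crank_gf k N (crank_binomial j)" for N
    unfolding crank_binomial_second_difference crank_gf_add crank_gf_cmult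
    by (simp add: fps_numeral_fps_const)
  then show ?thesis
    unfolding moment_gf_def crank_gf_step_crank_colors[where a = a and b = b, OF assms]
    by (simp add: power2_eq_square algebra_simps)
qed

lemma moment_gf_deriv:
  assumes k: "k \<ge> 2" and base: "\<And>j. moment_gf k 0 b (Suc j) = 0"
  defines "G \<equiv> \<lambda>a. Abs_fps (moment_gf k a b)"
  shows "fps_deriv (G a) = G a * Abs_fps (\<lambda>i. \<Sum>r<a. signed_koebe r ^ Suc i)"
proof (induction a)
  case 0
  show ?case by (rule fps_ext) (simp add: G_def base fps_mult_nth)
next
  case (Suc a)
  let ?x = "signed_monom a"
  have "(fps_const ((1 - ?x) ^ 2) - fps_const ?x * fps_X) * G (Suc a) = G a"
  proof (rule fps_ext)
    show "((fps_const ((1 - ?x) ^ 2) - fps_const ?x * fps_X) * G (Suc a)) $ j = G a $ j" for j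
      using moment_gf_0_step[OF k, of a b] moment_gf_Suc_step[OF k, of a b]
      by (cases j) (simp_all add: G_def left_diff_distrib mult.assoc)
  qed
  moreover have "(1 - ?x) ^ 2 \<noteq> 0"
  proof
    assume "(1 - ?x) ^ 2 = 0"
    then have "(1 - ?x) $ 0 = 0" by simp
    then show False by (simp add: signed_monom_nth_0)
  qed
  ultimately have "fps_deriv (G (Suc a)) = G (Suc a) *
      (Abs_fps (\<lambda>i. \<Sum>r<a. signed_koebe r ^ Suc i) + Abs_fps (\<lambda>i. signed_koebe a ^ Suc i))"
    by (rule logarithmic_derivative_step[OF _ _ signed_koebe_eq Suc.IH])
  moreover have "Abs_fps (\<lambda>i. \<Sum>r<a. signed_koebe r ^ Suc i) + Abs_fps (\<lambda>i. signed_koebe a ^ Suc i) =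
      Abs_fps (\<lambda>i. \<Sum>r<Suc a. signed_koebe r ^ Suc i)"
    by (rule fps_ext) simp
  ultimately show ?case by simp
qed

lemma moment_gf_pos:
  assumes k: "k \<ge> 2" and base: "\<And>j. moment_gf k 0 b (Suc j) = 0" and a: "a > 0"
    and g0: "fps_nonneg (moment_gf k a b 0)" "\<And>n. n \<le> L \<Longrightarrow> moment_gf k a b 0 $ n > 0"
    and n: "j \<le> n" "n \<le> L"
  shows "moment_gf k a b j $ n > 0"
proof (rule newton_recursion_pos[where g = "moment_gf k a b" and
    p = "\<lambda>i. \<Sum>r<a. signed_koebe r ^ Suc i", OF _ _ _ g0 n])
  fix j
  show "of_nat (Suc j) * moment_gf k a b (Suc j) =
      (\<Sum>i=0..j. moment_gf k a b i * (\<Sum>r<a. signed_koebe r ^ Suc (j - i)))"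
    using arg_cong[OF moment_gf_deriv[OF k base], of "\<lambda>f. f $ j" a]
    by (simp add: fps_mult_nth del: of_nat_Suc power_Suc)
qed (use a signed_koebe_power_sum_nonneg signed_koebe_sum_nth_1 in \<open>auto simp del: power_Suc simp: power_Suc0_right\<close>)

lemma moment_gf_0_prod:
  assumes "k \<ge> 2"
  shows "moment_gf k a b 0 * (\<Prod>r<a. 1 - signed_monom r) ^ 2 = moment_gf k 0 b 0"
proof (induction a)
  case (Suc a)
  have "moment_gf k (Suc a) b 0 * (\<Prod>r<Suc a. 1 - signed_monom r) ^ 2 =
      ((1 - signed_monom a) ^ 2 * moment_gf k (Suc a) b 0) * (\<Prod>r<a. 1 - signed_monom r) ^ 2"
    by (simp add: power_mult_distrib mult_ac)
  then show ?case
    unfolding moment_gf_0_step[where a = a and b = b, OF assms, symmetric] Suc.IH .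
qed simp

section \<open>Base cases: no parts in the crank colors\<close>

lemma moment_gf_two_base: "moment_gf 2 0 0 j = (if j = 0 then 1 else 0)"
proof -
  have "part_bounds 0 0 = (\<lambda>i. 0)" by (auto simp: part_bounds_def)
  then show ?thesis by (simp add: moment_gf_def crank_gf_0 crank_binomial_at_0)
qed

text \<open>A part r of the third color carries (-1)^r q^r = -x, where x is the signed monomial of
  that size, and so yields 1/(1 + x). The crank stays 0, where only the weight of order 0 is
  nonzero.\<close>

lemma moment_gf_three_base:
  "moment_gf 3 0 b j * (\<Prod>r<b. 1 + signed_monom r) = (if j = 0 then 1 else 0)"
proof (induction b)
  case 0
  have "part_bounds 0 0 = (\<lambda>i. 0)" by (auto simp: part_bounds_def)
  then show ?case by (simp add: moment_gf_def crank_gf_0 crank_binomial_at_0)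
next
  case (Suc b)
  have "part_bounds 0 (Suc b) 2 = Suc b" "(part_bounds 0 (Suc b))(2 := b) = part_bounds 0 b"
    by (auto simp: part_bounds_def)
  then have "moment_gf 3 0 (Suc b) j = moment_gf 3 0 b j - signed_monom b * moment_gf 3 0 (Suc b) j"
    using crank_gf_step[where k = 3 and i = 2 and N = "part_bounds 0 (Suc b)" and \<phi> = "crank_binomial j"]
    by (simp add: moment_gf_def signed_monom_def fps_const_neg[symmetric] del: fps_const_neg fun_upd_apply)
  then have "(1 + signed_monom b) * moment_gf 3 0 (Suc b) j = moment_gf 3 0 b j"
    by (simp add: algebra_simps)
  moreover have "moment_gf 3 0 (Suc b) j * (\<Prod>r<Suc b. 1 + signed_monom r) =
      (1 + signed_monom b) * moment_gf 3 0 (Suc b) j * (\<Prod>r<b. 1 + signed_monom r)"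
    by (simp only: prod.lessThan_Suc mult_ac)
  ultimately show ?case by (simp only: Suc.IH)
qed

lemma moment_gf_three_base_Suc: "moment_gf 3 0 b (Suc j) = 0"
proof -
  have "(\<Prod>r<b. 1 + signed_monom r) \<noteq> 0"
  proof -
    have "1 + signed_monom r \<noteq> 0" for r
      by (metis add.right_neutral fps_add_nth fps_one_nth fps_zero_nth signed_monom_nth_0 zero_neq_one)
    then show ?thesis by simp
  qed
  then show ?thesis using moment_gf_three_base[of b "Suc j"] by simp
qed

section \<open>The case of order zero\<close>

definition odd_prod :: "nat \<Rightarrow> real fps" where
  "odd_prod N = (\<Prod>s<N. 1 + fps_X ^ (2 * s + 1))"

definition even_prod :: "nat set \<Rightarrow> real fps" where
  "even_prod S = (\<Prod>s\<in>S. 1 - fps_X ^ (2 * s + 2))"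

definition even_prod_inv :: "nat set \<Rightarrow> real fps" where
  "even_prod_inv S = (\<Prod>s\<in>S. geom (2 * s + 2))"

lemma signed_monom_even: "signed_monom (2 * s) = fps_X ^ (2 * s + 1)"
  and signed_monom_odd: "signed_monom (Suc (2 * s)) = - (fps_X ^ (2 * s + 2))"
  by (simp_all add: signed_monom_def flip: fps_const_neg)

lemma prod_one_plus_signed_monom: "(\<Prod>r<2 * N. 1 + signed_monom r) = odd_prod N * even_prod {..<N}"
proof (induction N)
  case (Suc N)
  have "(\<Prod>r<2 * Suc N. 1 + signed_monom r) =
      (\<Prod>r<2 * N. 1 + signed_monom r) * ((1 + signed_monom (2 * N)) * (1 + signed_monom (Suc (2 * N))))"
    by (simp add: mult.assoc)
  then show ?case
    unfolding Suc.IH signed_monom_even signed_monom_odd odd_prod_def even_prod_def prod.lessThan_Suc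
    by (simp only: mult_ac diff_conv_add_uminus)
qed (simp add: odd_prod_def even_prod_def)

lemma even_prod_nth_0: "finite S \<Longrightarrow> even_prod S $ 0 = 1"
  by (simp add: even_prod_def fps_nth_0_prod)

text \<open>Euler's identity in truncated form; the right-hand side is the truncation error.\<close>

lemma prod_one_minus_signed_monom:
  "(\<Prod>r<2 * N. 1 - signed_monom r) * odd_prod N = even_prod {N..<2 * N}"
proof -
  \<comment> \<open>With the extra factor, each 1 - y meets 1 + y. The exponents of the products 1 -
    y^2 are 4s + 2 and 4s + 4 for s < N, that is, all positive even numbers up to 4N.\<close>
  have "(\<Prod>r<2 * N. 1 - signed_monom r) * odd_prod N * even_prod {..<N} = even_prod {..<2 * N}"
  proof (induction N)
    case (Suc N)
    let ?A = "\<Prod>r<2 * N. 1 - signed_monom r"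
    have "(1 - y) * (1 + y) = 1 - y ^ 2" for y :: "real fps"
      by (simp add: power2_eq_square algebra_simps)
    from this[of "fps_X ^ (2 * N + 1)"] this[of "fps_X ^ (2 * N + 2)"]
    have eq: "(1 - fps_X ^ (2 * N + 1)) * (1 + fps_X ^ (2 * N + 1)) = 1 - (fps_X :: real fps) ^ (2 * (2 * N) + 2)"
      "(1 - fps_X ^ (2 * N + 2)) * (1 + fps_X ^ (2 * N + 2)) = 1 - (fps_X :: real fps) ^ (2 * (2 * N + 1) + 2)"
      by (simp_all add: algebra_simps del: power_Suc flip: power_mult)
    have split: "(\<Prod>r<2 * Suc N. 1 - signed_monom r) =
        ?A * ((1 - signed_monom (2 * N)) * (1 - signed_monom (Suc (2 * N))))"
      by (simp add: mult.assoc)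
    have "(\<Prod>r<2 * Suc N. 1 - signed_monom r) * odd_prod (Suc N) * even_prod {..<Suc N} =
      (?A * odd_prod N * even_prod {..<N}) *
      ((1 - fps_X ^ (2 * N + 1)) * (1 + fps_X ^ (2 * N + 1))) *
      ((1 - fps_X ^ (2 * N + 2)) * (1 + fps_X ^ (2 * N + 2)))"
      unfolding split odd_prod_def even_prod_def signed_monom_even signed_monom_odd prod.lessThan_Suc
      by (simp only: diff_minus_eq_add mult_ac)
    also have "\<dots> = even_prod {..<2 * Suc N}"
      unfolding eq Suc.IH by (simp add: even_prod_def mult_ac del: power_Suc)
    finally show ?case .
  qed (simp_all add: odd_prod_def even_prod_def)
  also have "even_prod {..<2 * N} = even_prod {N..<2 * N} * even_prod {..<N}"
    unfolding even_prod_def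
    by (subst prod.union_disjoint[symmetric]) (auto intro!: prod.cong)
  finally show ?thesis
    using even_prod_nth_0[of "{..<N}"] by force
qed

lemma even_prod_inv_times: "even_prod_inv S * even_prod S = 1"
  unfolding even_prod_def even_prod_inv_def prod.distrib[symmetric]
  by (intro prod.neutral ballI geom_times) simp

lemma fps_nonneg_even_prod_inv: "fps_nonneg (even_prod_inv S)"
  unfolding even_prod_inv_def by (intro fps_nonneg_prod fps_nonneg_geom)

lemma fps_nonneg_odd_prod: "fps_nonneg (odd_prod N)"
  unfolding odd_prod_def by (intro fps_nonneg_prod fps_nonneg_add fps_nonneg_1 fps_nonneg_X_power)

lemma odd_prod_nth_0: "odd_prod N $ 0 = 1"
  by (simp add: odd_prod_def fps_nth_0_prod)

text \<open>Take q^n from its own factor, present because n < 2N, and 1 from all others.\<close>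

lemma odd_prod_nth_pos:
  assumes "odd n" "n < 2 * N"
  shows "odd_prod N $ n > 0"
proof -
  obtain s where s: "n = 2 * s + 1" using assms(1) by (elim oddE)
  let ?R = "\<Prod>s\<in>{..<N} - {s}. 1 + fps_X ^ (2 * s + 1) :: real fps"
  have "odd_prod N = (1 + fps_X ^ n) * ?R"
    unfolding odd_prod_def s using assms s by (subst prod.remove[of _ s]) auto
  moreover have "((1 + fps_X ^ n) * ?R) $ (n + 0) > 0"
    using s by (intro fps_mult_nth_pos fps_nonneg_prod fps_nonneg_add fps_nonneg_1 fps_nonneg_X_power)
      (simp_all add: fps_X_power_nth fps_nth_0_prod)
  ultimately show ?thesis by simp
qed

lemma even_prod_inv_nth_0: "even_prod_inv S $ 0 = 1"
  by (simp add: even_prod_inv_def fps_nth_0_prod geom_nth_0)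

text \<open>The factor \<open>geom 2\<close>, coming from s = 0, already reaches every even
  exponent.\<close>

lemma even_prod_inv_nth_pos:
  assumes "even n" "N > 0"
  shows "even_prod_inv {..<N} $ n > 0"
proof -
  let ?R = "even_prod_inv ({..<N} - {0})"
  have "even_prod_inv {..<N} = geom 2 * ?R"
    unfolding even_prod_inv_def
    using assms by (subst prod.remove[of _ 0]) (auto simp: numeral_2_eq_2)
  moreover have "(geom 2 * ?R) $ (n + 0) > 0"
    by (intro fps_mult_nth_pos fps_nonneg_geom fps_nonneg_even_prod_inv geom_2_nth_pos assms)
      (simp add: even_prod_inv_nth_0)
  ultimately show ?thesis by simp
qed

lemma moment_gf_two_0:
  "moment_gf 2 (2 * N) 0 0 = odd_prod N ^ 2 * even_prod_inv {N..<2 * N} ^ 2"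
proof -
  let ?A = "\<Prod>r<2 * N. 1 - signed_monom r" and ?H = "even_prod_inv {N..<2 * N}"
  \<comment> \<open>The inserted factor is 1 by the truncated Euler identity.\<close>
  have "moment_gf 2 (2 * N) 0 0 = moment_gf 2 (2 * N) 0 0 * (?H * (?A * odd_prod N)) ^ 2"
    by (simp add: prod_one_minus_signed_monom even_prod_inv_times)
  also have "\<dots> = (moment_gf 2 (2 * N) 0 0 * ?A ^ 2) * (odd_prod N ^ 2 * ?H ^ 2)"
    by (simp add: power_mult_distrib mult_ac)
  finally show ?thesis
    by (simp add: moment_gf_0_prod moment_gf_two_base)
qed

text \<open>Compared with two colors, the third contributes the reciprocal of
  \<open>odd_prod N * even_prod {..<N}\<close>, which cancels one of the two factors
  \<open>odd_prod N\<close>.\<close>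

lemma moment_gf_three_0:
  "moment_gf 3 (2 * N) (2 * N) 0 =
     odd_prod N * even_prod_inv {..<N} * even_prod_inv {N..<2 * N} ^ 2"
proof -
  let ?A = "\<Prod>r<2 * N. 1 - signed_monom r" and ?H = "even_prod_inv {N..<2 * N}" and ?I = "even_prod_inv {..<N}"
    and ?g = "moment_gf 3 (2 * N) (2 * N) 0"
  have "?g = ?g * (?H * (?A * odd_prod N)) ^ 2 * (?I * even_prod {..<N})"
    by (simp add: prod_one_minus_signed_monom even_prod_inv_times)
  also have "\<dots> = (?g * ?A ^ 2 * (odd_prod N * even_prod {..<N})) * (odd_prod N * ?I * ?H ^ 2)"
    by (simp add: power_mult_distrib power2_eq_square mult_ac)
  also have "?g * ?A ^ 2 * (odd_prod N * even_prod {..<N}) = 1"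
    using moment_gf_three_base[of "2 * N" 0]
    by (simp add: moment_gf_0_prod prod_one_plus_signed_monom)
  finally show ?thesis by simp
qed

text \<open>A single \<open>odd_prod N\<close> would not do, as 2 is no sum of distinct odd numbers.
  With two factors, split an odd n as n + 0 and a positive even n as (n - 1) + 1.\<close>

lemma odd_prod_square_nth_pos:
  assumes "n < 2 * N"
  shows "(odd_prod N ^ 2) $ n > 0"
proof -
  obtain i l where il: "n = i + l" "odd_prod N $ i > 0" "odd_prod N $ l > 0"
  proof (cases "odd n \<or> n = 0")
    case True
    then show ?thesis
      using that[of n 0] assms by (auto simp: odd_prod_nth_0 odd_prod_nth_pos)
  next
    case False
    then show ?thesis
      using that[of "n - 1" 1] assms odd_prod_nth_pos[of "n - 1" N] odd_prod_nth_pos[of 1 N] by auto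
  qed
  then show ?thesis
    unfolding power2_eq_square il(1) by (intro fps_mult_nth_pos fps_nonneg_odd_prod)
qed

text \<open>The odd part 1 corrects the parity, and the even rest comes from
  \<open>even_prod_inv\<close>.\<close>

lemma odd_prod_even_prod_inv_nth_pos:
  assumes "N > 0"
  shows "(odd_prod N * even_prod_inv {..<N}) $ n > 0"
proof -
  obtain i l where il: "n = i + l" "odd_prod N $ i > 0" "even l"
  proof (cases "even n")
    case True
    then show ?thesis using that[of 0 n] by (simp add: odd_prod_nth_0)
  next
    case False
    then have "n = 1 + (n - 1)" "even (n - 1)" by (auto elim: oddE)
    then show ?thesis using that[of 1 "n - 1"] odd_prod_nth_pos[of 1 N] assms by simp
  qed
  show ?thesis
    unfolding il(1)
    by (intro fps_mult_nth_pos fps_nonneg_odd_prod fps_nonneg_even_prod_inv even_prod_inv_nth_pos il assms)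
qed

theorem theorem3p2:
  fixes n j :: nat
  assumes "j \<le> n"
  shows "(- 1) ^ n * mu_minus_one j 2 n > 0 \<and> (- 1) ^ n * mu_minus_one j 3 n > 0"
proof
  \<comment> \<open>Any N with n < 2N works: sizes up to 2N include all parts that can occur, and
    the order-zero series are positive up to exponent 2N - 1.\<close>
  define N where "N = Suc n"
  let ?H = "even_prod_inv {N..<2 * N} ^ 2"
  have N: "N > 0" "2 * N > 0" and nN: "n \<le> 2 * N - 1" by (auto simp: N_def)
  have H: "fps_nonneg ?H" "?H $ 0 > 0"
    by (intro fps_nonneg_power fps_nonneg_even_prod_inv) (simp add: power2_eq_square even_prod_inv_nth_0)
  have "moment_gf 2 (2 * N) 0 j $ n > 0"
  proof (rule moment_gf_pos[OF _ _ N(2) _ _ assms nN])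
    show "fps_nonneg (moment_gf 2 (2 * N) 0 0)"
      unfolding moment_gf_two_0
      by (intro fps_nonneg_mult fps_nonneg_power fps_nonneg_odd_prod H)
    fix m assume "m \<le> 2 * N - 1"
    \<comment> \<open>The correction \<open>?H\<close> for the truncation is nonnegative with
      constant term 1, so it preserves positivity at each exponent.\<close>
    then have "(odd_prod N ^ 2 * ?H) $ (m + 0) > 0"
      using N by (intro fps_mult_nth_pos fps_nonneg_power[OF fps_nonneg_odd_prod] odd_prod_square_nth_pos H) auto
    then show "moment_gf 2 (2 * N) 0 0 $ m > 0" by (simp add: moment_gf_two_0)
  qed (simp_all add: moment_gf_two_base)
  then show "(- 1) ^ n * mu_minus_one j 2 n > 0"
    using mu_minus_one_eq_coeff[of 2 n "part_bounds (2 * N) 0" j]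
    by (simp add: moment_gf_def part_bounds_def N_def)
  have "moment_gf 3 (2 * N) (2 * N) j $ n > 0"
  proof (rule moment_gf_pos[OF _ _ N(2) _ _ assms nN])
    show "fps_nonneg (moment_gf 3 (2 * N) (2 * N) 0)"
      unfolding moment_gf_three_0
      by (intro fps_nonneg_mult fps_nonneg_odd_prod fps_nonneg_even_prod_inv H)
    fix m
    have "(odd_prod N * even_prod_inv {..<N} * ?H) $ (m + 0) > 0"
      by (intro fps_mult_nth_pos fps_nonneg_mult fps_nonneg_odd_prod fps_nonneg_even_prod_inv
          odd_prod_even_prod_inv_nth_pos N H)
    then show "moment_gf 3 (2 * N) (2 * N) 0 $ m > 0" by (simp add: moment_gf_three_0)
  qed (simp_all add: moment_gf_three_base_Suc)
  then show "(- 1) ^ n * mu_minus_one j 3 n > 0"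
    using mu_minus_one_eq_coeff[of 3 n "part_bounds (2 * N) (2 * N)" j]
    by (simp add: moment_gf_def part_bounds_def N_def)
qed

end
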